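(* Let $\eta,\mu$ be real parameters, $a<b$, $\Delta t>0$, $N$ a positive even integer, $s\ge 1$ and $N_t\ge1$ integers, and let $a_{ij},b_i$ ($i,j=1,\dots,s$) be real Runge-Kutta coefficients satisfying the symplectic condition $$b_ia_{ij}+b_ja_{ji}=b_ib_j\qquad\text{for all } i,j=1,\dots,s .$$ Let $(u^n,q^n)_{0\le n\le N_t}$ be a sequence in $V_h\times V_h$ such that, for each $0\le n<N_t$, there are $U_i,Q_i,k_i,l_i\in V_h$ ($i=1,\dots,s$, depending on $n$) satisfying the fully discrete QAV-RK scheme $$U_i=u^n+\Delta t\sum_{j=1}^sa_{ij}k_j,\qquad Q_i=q^n+\Delta t\sum_{j=1}^sa_{ij}l_j,$$ $$k_i=D_1\left(-\frac{\eta}{6}Q_i-\frac{\eta}{3}U_i^2-\mu^2D_1^2U_i\right),\qquad l_i=2U_ik_i\qquad(i=1,\dots,s),$$ $$u^{n+1}=u^n+\Delta t\sum_{i=1}^sb_ik_i,\qquad q^{n+1}=q^n+\Delta t\sum_{i=1}^sb_il_i .$$ If the consistent initial condition $q^0=\big(u^0\big)^2$ holds, then the original discrete energy is conserved: $$\mathcal{H}^n=\mathcal{H}^0\qquad\text{for all } 0\le n\le N_t,$$ where $\mathcal{H}^n=-\frac{\eta}{6}\big((u^n)^3,1\big)_h+\frac{\mu^2}{2}\|D_1u^n\|_h^2$.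
   Context: Let $h=(b-a)/N$ and $x_j=a+jh$, $j=0,\dots,N-1$. $V_h\cong\mathbb{R}^N$ is the space of real grid functions $u=(u_j)_{0\le j\le N-1}$, $u_j=u(x_j)$. Products and powers of grid functions (such as $U_i^2$, $U_ik_i$, $(u^n)^2$, $(u^n)^3$) are taken componentwise, and $1$ denotes the constant grid function $(1,\dots,1)^T$. The discrete inner product and norm are $(u,v)_h=h\sum_{j=0}^{N-1}u_jv_j$ and $\|u\|_h=\sqrt{(u,u)_h}$. $D_1$ is the first-order Fourier (pseudo-spectral) differentiation matrix on this periodic grid, i.e. the real $N\times N$ matrix with entries $(D_1)_{jl}=\frac{\pi}{b-a}(-1)^{j+l}\cot\left(\frac{\pi(x_j-x_l)}{b-a}\right)$ for $j\ne l$ and $(D_1)_{jj}=0$, $0\le j,l\le N-1$. *)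

theory Defs
  imports Complex_Main "Jordan_Normal_Form.Matrix"
begin

text \<open>Grid functions on the periodic grid with N points are real vectors in
  \<open>carrier_vec N\<close>, with components indexed by 0, ..., N - 1.\<close>

definition mesh_size :: "real \<Rightarrow> real \<Rightarrow> nat \<Rightarrow> real" where
  "mesh_size a b N = (b - a) / real N"

definition grid_point :: "real \<Rightarrow> real \<Rightarrow> nat \<Rightarrow> nat \<Rightarrow> real" where
  "grid_point a b N j = a + real j * mesh_size a b N"

definition grid_mult :: "real vec \<Rightarrow> real vec \<Rightarrow> real vec" (infixl "\<odot>" 70) where
  "u \<odot> v = vec (dim_vec v) (\<lambda>j. u $ j * v $ j)"

definition grid_pow :: "real vec \<Rightarrow> nat \<Rightarrow> real vec" (infixr "^\<^sub>v" 75) where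
  "u ^\<^sub>v m = map_vec (\<lambda>x. x ^ m) u"

definition grid_one :: "nat \<Rightarrow> real vec" where
  "grid_one N = vec N (\<lambda>_. 1)"

definition inner_h :: "real \<Rightarrow> real \<Rightarrow> nat \<Rightarrow> real vec \<Rightarrow> real vec \<Rightarrow> real" where
  "inner_h a b N u v = mesh_size a b N * (u \<bullet> v)"

definition norm_h :: "real \<Rightarrow> real \<Rightarrow> nat \<Rightarrow> real vec \<Rightarrow> real" where
  "norm_h a b N u = sqrt (inner_h a b N u u)"

definition fourier_D1 :: "real \<Rightarrow> real \<Rightarrow> nat \<Rightarrow> real mat" where
  "fourier_D1 a b N = mat N N (\<lambda>(j, l).
     if j = l then 0
     else pi / (b - a) * (-1) ^ (j + l)
            * cot (pi * (grid_point a b N j - grid_point a b N l) / (b - a)))"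

text \<open>The Runge-Kutta coefficients are \<open>A i j\<close> and weights \<open>w i\<close> with
  i, j in 1, ..., s; values outside this index range are irrelevant.\<close>

definition symplectic_rk :: "nat \<Rightarrow> (nat \<Rightarrow> nat \<Rightarrow> real) \<Rightarrow> (nat \<Rightarrow> real) \<Rightarrow> bool" where
  "symplectic_rk s A w \<longleftrightarrow>
     (\<forall>i\<in>{1..s}. \<forall>j\<in>{1..s}. w i * A i j + w j * A j i = w i * w j)"

text \<open>One time step \<open>(u, q) \<mapsto> (u', q')\<close> of the fully discrete QAV-RK scheme.
  The stages may be given implicitly; they are only required to exist.\<close>

definition qav_rk_step ::
  "real \<Rightarrow> real \<Rightarrow> nat \<Rightarrow> real \<Rightarrow> real \<Rightarrow> real \<Rightarrow> nat \<Rightarrow> (nat \<Rightarrow> nat \<Rightarrow> real) \<Rightarrow> (nat \<Rightarrow> real)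
     \<Rightarrow> real vec \<Rightarrow> real vec \<Rightarrow> real vec \<Rightarrow> real vec \<Rightarrow> bool" where
  "qav_rk_step a b N \<eta> \<mu> dt s A w u q u' q' \<longleftrightarrow>
     (\<exists>U Q k l :: nat \<Rightarrow> real vec.
        (\<forall>i\<in>{1..s}. U i \<in> carrier_vec N \<and> Q i \<in> carrier_vec N
                  \<and> k i \<in> carrier_vec N \<and> l i \<in> carrier_vec N) \<and>
        (\<forall>i\<in>{1..s}.
           U i = u + dt \<cdot>\<^sub>v finsum_vec TYPE(real) N (\<lambda>j. A i j \<cdot>\<^sub>v k j) {1..s} \<and>
           Q i = q + dt \<cdot>\<^sub>v finsum_vec TYPE(real) N (\<lambda>j. A i j \<cdot>\<^sub>v l j) {1..s} \<and>
           k i = fourier_D1 a b N *\<^sub>v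
                   ((- \<eta> / 6) \<cdot>\<^sub>v Q i - (\<eta> / 3) \<cdot>\<^sub>v (U i ^\<^sub>v 2)
                      - \<mu>\<^sup>2 \<cdot>\<^sub>v ((fourier_D1 a b N ^\<^sub>m 2) *\<^sub>v U i)) \<and>
           l i = 2 \<cdot>\<^sub>v (U i \<odot> k i)) \<and>
        u' = u + dt \<cdot>\<^sub>v finsum_vec TYPE(real) N (\<lambda>i. w i \<cdot>\<^sub>v k i) {1..s} \<and>
        q' = q + dt \<cdot>\<^sub>v finsum_vec TYPE(real) N (\<lambda>i. w i \<cdot>\<^sub>v l i) {1..s})"

definition discrete_energy :: "real \<Rightarrow> real \<Rightarrow> nat \<Rightarrow> real \<Rightarrow> real \<Rightarrow> real vec \<Rightarrow> real" where
  "discrete_energy a b N \<eta> \<mu> u =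
     - \<eta> / 6 * inner_h a b N (u ^\<^sub>v 3) (grid_one N)
     + \<mu>\<^sup>2 / 2 * (norm_h a b N (fourier_D1 a b N *\<^sub>v u))\<^sup>2"

end

theory Submission
  imports Defs
begin

text \<open>A symplectic Runge-Kutta method satisfies an exact product rule: \<open>u * v\<close> changes over one step
  by the weighted sum of its stage derivatives. Applied componentwise to \<open>u * u\<close>, it
  propagates \<open>q = u\<^sup>2\<close>, under which the original energy equals the quadratic energy
  \<open>- \<eta>/6 (u, q) + \<mu>\<^sup>2/2 (D u, D u)\<close>. Applied to the latter, it gives the stage
  derivatives \<open>(k, g)\<close> with \<open>k = D g\<close> and \<open>g\<close> the variational derivative, and these vanish
  because \<open>D\<close> is skew-symmetric.\<close>

section \<open>Runge-Kutta combinations of grid vectors\<close>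

text \<open>The stages and the update have the same shape: \<open>c\<close> is the row
  \<open>A i\<close> for a stage and the weights \<open>w\<close> for the new value.\<close>

abbreviation rk_comb ::
  "nat \<Rightarrow> real \<Rightarrow> nat \<Rightarrow> (nat \<Rightarrow> real) \<Rightarrow> (nat \<Rightarrow> real vec) \<Rightarrow> real vec \<Rightarrow> real vec" where
  "rk_comb n dt s c k u \<equiv> u + dt \<cdot>\<^sub>v finsum_vec TYPE(real) n (\<lambda>j. c j \<cdot>\<^sub>v k j) {1..s}"

lemma finsum_vec_smult_carrier:
  assumes "k \<in> {1..s} \<rightarrow> carrier_vec n"
  shows "finsum_vec TYPE(real) n (\<lambda>j. c j \<cdot>\<^sub>v k j) {1..s} \<in> carrier_vec n"
  using assms by (intro finsum_vec_closed) auto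

lemma rk_comb_carrier:
  assumes "u \<in> carrier_vec n" and "k \<in> {1..s} \<rightarrow> carrier_vec n"
  shows "rk_comb n dt s c k u \<in> carrier_vec n"
  using assms finsum_vec_smult_carrier[OF assms(2)] by simp

lemma rk_comb_index:
  assumes "u \<in> carrier_vec n" and k: "k \<in> {1..s} \<rightarrow> carrier_vec n" and "x < n"
  shows "rk_comb n dt s c k u $ x = u $ x + dt * (\<Sum>j\<in>{1..s}. c j * k j $ x)"
proof -
  have "finsum_vec TYPE(real) n (\<lambda>j. c j \<cdot>\<^sub>v k j) {1..s} $ x = (\<Sum>j\<in>{1..s}. (c j \<cdot>\<^sub>v k j) $ x)"
    using assms by (intro index_finsum_vec) auto
  also have "\<dots> = (\<Sum>j\<in>{1..s}. c j * k j $ x)"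
    using k \<open>x < n\<close> by (intro sum.cong refl) (auto dest!: funcset_mem)
  finally show ?thesis
    using assms finsum_vec_smult_carrier[OF k, of c] by simp
qed

lemma mult_mat_vec_index_sum:
  assumes "D \<in> carrier_mat n n" "v \<in> carrier_vec n" "x < n"
  shows "(D *\<^sub>v v) $ x = (\<Sum>y<n. D $$ (x, y) * v $ y)"
  using assms by (auto simp: scalar_prod_def atLeast0LessThan)

text \<open>Linearity of \<open>D\<close>. It shows that \<open>D *\<^sub>v u\<close> is advanced by
  the same method with stage derivatives \<open>D *\<^sub>v k j\<close>, so the product rule also
  applies to the gradient term of the energy.\<close>

lemma mult_mat_rk_comb:
  assumes D: "D \<in> carrier_mat n n" and u: "u \<in> carrier_vec n"
    and k: "k \<in> {1..s} \<rightarrow> carrier_vec n"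
  shows "D *\<^sub>v rk_comb n dt s c k u = rk_comb n dt s c (\<lambda>j. D *\<^sub>v k j) (D *\<^sub>v u)"
proof (rule eq_vecI)
  have Du: "D *\<^sub>v u \<in> carrier_vec n" and Dk: "(\<lambda>j. D *\<^sub>v k j) \<in> {1..s} \<rightarrow> carrier_vec n"
    using D u funcset_mem[OF k] by (auto intro!: Pi_I)
  note comb = rk_comb_carrier[OF Du Dk, of dt c]
  show "dim_vec (D *\<^sub>v rk_comb n dt s c k u) = dim_vec (rk_comb n dt s c (\<lambda>j. D *\<^sub>v k j) (D *\<^sub>v u))"
    using D by (simp only: carrier_vecD[OF comb] dim_mult_mat_vec carrier_matD)
  fix x assume "x < dim_vec (rk_comb n dt s c (\<lambda>j. D *\<^sub>v k j) (D *\<^sub>v u))"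
  then have x: "x < n" by (simp only: carrier_vecD[OF comb])
  have "(D *\<^sub>v rk_comb n dt s c k u) $ x
      = (\<Sum>y<n. D $$ (x, y) * (u $ y + dt * (\<Sum>j\<in>{1..s}. c j * k j $ y)))"
    unfolding mult_mat_vec_index_sum[OF D rk_comb_carrier[OF u k] x]
    by (intro sum.cong refl arg_cong2[of _ _ _ _ "(*)"] rk_comb_index u k) auto
  also have "\<dots> = (\<Sum>y<n. D $$ (x, y) * u $ y)
      + dt * (\<Sum>y<n. \<Sum>j\<in>{1..s}. c j * (D $$ (x, y) * k j $ y))"
    by (simp add: algebra_simps sum.distrib sum_distrib_left)
  also have "(\<Sum>y<n. \<Sum>j\<in>{1..s}. c j * (D $$ (x, y) * k j $ y))
      = (\<Sum>j\<in>{1..s}. c j * (\<Sum>y<n. D $$ (x, y) * k j $ y))"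
    by (subst sum.swap) (simp add: sum_distrib_left)
  also have "\<dots> = (\<Sum>j\<in>{1..s}. c j * (D *\<^sub>v k j) $ x)"
    using mult_mat_vec_index_sum[OF D funcset_mem[OF k] x] by (intro sum.cong refl) simp
  finally show "(D *\<^sub>v rk_comb n dt s c k u) $ x
      = rk_comb n dt s c (\<lambda>j. D *\<^sub>v k j) (D *\<^sub>v u) $ x"
    by (simp only: rk_comb_index[OF Du Dk x] mult_mat_vec_index_sum[OF D u x])
qed

section \<open>Product rule of symplectic methods\<close>

text \<open>Inserting the stages on the right gives the terms linear in \<open>dt\<close> and two
  double sums with coefficients \<open>w i * A i j\<close>. The symplectic condition merges these
  into the \<open>dt\<^sup>2\<close> term of the product on the left.\<close>

lemma symplectic_rk_product_rule:
  fixes u v dt :: real and U V k m :: "nat \<Rightarrow> real"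
  assumes symp: "symplectic_rk s A w"
    and U: "\<forall>i\<in>{1..s}. U i = u + dt * (\<Sum>j\<in>{1..s}. A i j * k j)"
    and V: "\<forall>i\<in>{1..s}. V i = v + dt * (\<Sum>j\<in>{1..s}. A i j * m j)"
  shows "(u + dt * (\<Sum>i\<in>{1..s}. w i * k i)) * (v + dt * (\<Sum>i\<in>{1..s}. w i * m i))
       = u * v + dt * (\<Sum>i\<in>{1..s}. w i * (U i * m i + k i * V i))"
proof -
  let ?I = "{1..s}"
  have "(\<Sum>i\<in>?I. w i * (U i * m i + k i * V i))
      = (\<Sum>i\<in>?I. w i * ((u + dt * (\<Sum>j\<in>?I. A i j * k j)) * m i
                       + k i * (v + dt * (\<Sum>j\<in>?I. A i j * m j))))"
    using U V by (intro sum.cong) auto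
  also have "\<dots> = u * (\<Sum>i\<in>?I. w i * m i) + v * (\<Sum>i\<in>?I. w i * k i)
      + dt * ((\<Sum>i\<in>?I. \<Sum>j\<in>?I. w i * A i j * (k j * m i))
            + (\<Sum>i\<in>?I. \<Sum>j\<in>?I. w i * A i j * (k i * m j)))"
    by (simp add: algebra_simps sum.distrib sum_distrib_left)
  \<comment> \<open>Exchanging the indices gives both double sums the common factor
    \<open>k j * m i\<close>, so that their coefficients can be added.\<close>
  also have "(\<Sum>i\<in>?I. \<Sum>j\<in>?I. w i * A i j * (k i * m j))
      = (\<Sum>i\<in>?I. \<Sum>j\<in>?I. w j * A j i * (k j * m i))"
    by (rule sum.swap)
  also have "(\<Sum>i\<in>?I. \<Sum>j\<in>?I. w i * A i j * (k j * m i)) + \<dots>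
      = (\<Sum>i\<in>?I. \<Sum>j\<in>?I. (w i * A i j + w j * A j i) * (k j * m i))"
    by (simp add: sum.distrib distrib_right)
  also have "\<dots> = (\<Sum>i\<in>?I. \<Sum>j\<in>?I. (w i * m i) * (w j * k j))"
    using symp by (intro sum.cong refl) (auto simp: symplectic_rk_def)
  also have "\<dots> = (\<Sum>i\<in>?I. w i * m i) * (\<Sum>j\<in>?I. w j * k j)"
    by (simp add: sum_product)
  finally show ?thesis by (simp add: algebra_simps)
qed

lemma symplectic_rk_scalar_prod:
  assumes symp: "symplectic_rk s A w"
    and u: "u \<in> carrier_vec n" and v: "v \<in> carrier_vec n"
    and k: "k \<in> {1..s} \<rightarrow> carrier_vec n"
    and m: "m \<in> {1..s} \<rightarrow> carrier_vec n"
    and U: "\<forall>i\<in>{1..s}. U i = rk_comb n dt s (A i) k u"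
    and V: "\<forall>i\<in>{1..s}. V i = rk_comb n dt s (A i) m v"
  shows "rk_comb n dt s w k u \<bullet> rk_comb n dt s w m v
       = u \<bullet> v + dt * (\<Sum>i\<in>{1..s}. w i * (U i \<bullet> m i + k i \<bullet> V i))"
proof -
  have sp: "x \<bullet> y = (\<Sum>i<n. x $ i * y $ i)" if "y \<in> carrier_vec n" for x y :: "real vec"
    using that by (auto simp: scalar_prod_def atLeast0LessThan)
  have "rk_comb n dt s w k u \<bullet> rk_comb n dt s w m v
      = (\<Sum>x<n. (u $ x + dt * (\<Sum>i\<in>{1..s}. w i * k i $ x)) * (v $ x + dt * (\<Sum>i\<in>{1..s}. w i * m i $ x)))"
    unfolding sp[OF rk_comb_carrier[OF v m]]
    by (intro sum.cong refl arg_cong2[of _ _ _ _ "(*)"] rk_comb_index u v k m) auto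
  also have "\<dots> = (\<Sum>x<n. u $ x * v $ x
      + dt * (\<Sum>i\<in>{1..s}. w i * (U i $ x * m i $ x + k i $ x * V i $ x)))"
    by (intro sum.cong refl symplectic_rk_product_rule[OF symp])
       (intro ballI, simp only: bspec[OF U] bspec[OF V] rk_comb_index[OF u k] rk_comb_index[OF v m] lessThan_iff)+
  also have "\<dots> = u \<bullet> v + dt * (\<Sum>x<n. \<Sum>i\<in>{1..s}. w i * (U i $ x * m i $ x + k i $ x * V i $ x))"
    by (simp only: sp[OF v] sum.distrib sum_distrib_left)
  also have "(\<Sum>x<n. \<Sum>i\<in>{1..s}. w i * (U i $ x * m i $ x + k i $ x * V i $ x))
      = (\<Sum>i\<in>{1..s}. w i * (\<Sum>x<n. U i $ x * m i $ x + k i $ x * V i $ x))"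
    by (subst sum.swap) (simp only: sum_distrib_left)
  also have "\<dots> = (\<Sum>i\<in>{1..s}. w i * (U i \<bullet> m i + k i \<bullet> V i))"
    by (intro sum.cong refl) (simp only: bspec[OF V] sp funcset_mem[OF m] rk_comb_carrier[OF v m] sum.distrib)
  finally show ?thesis .
qed

section \<open>Skew-symmetry of the Fourier differentiation matrix\<close>

lemma fourier_D1_carrier: "fourier_D1 a b N \<in> carrier_mat N N"
  by (simp add: fourier_D1_def)

text \<open>The cotangent is odd, the sign \<open>(-1) ^ (j + l)\<close> is symmetric in the
  indices, and the diagonal vanishes.\<close>

lemma fourier_D1_skew:
  assumes "x < N" "y < N"
  shows "fourier_D1 a b N $$ (y, x) = - fourier_D1 a b N $$ (x, y)"
proof -
  have "pi * (grid_point a b N y - grid_point a b N x) / (b - a)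
      = - (pi * (grid_point a b N x - grid_point a b N y) / (b - a))"
    by (simp add: minus_divide_left algebra_simps)
  then show ?thesis using assms
    by (simp add: fourier_D1_def add.commute)
qed

text \<open>Discrete integration by parts on the periodic grid, without boundary terms.\<close>

lemma fourier_D1_scalar_prod:
  assumes u: "u \<in> carrier_vec N" and v: "v \<in> carrier_vec N"
  shows "(fourier_D1 a b N *\<^sub>v u) \<bullet> v = - (u \<bullet> (fourier_D1 a b N *\<^sub>v v))"
proof -
  let ?D = "fourier_D1 a b N"
  note D = fourier_D1_carrier[of a b N]
  have "(?D *\<^sub>v u) \<bullet> v = (\<Sum>x<N. (\<Sum>y<N. ?D $$ (x, y) * u $ y) * v $ x)"
    using v mult_mat_vec_index_sum[OF D u] by (auto simp: scalar_prod_def atLeast0LessThan)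
  also have "\<dots> = (\<Sum>y<N. \<Sum>x<N. ?D $$ (x, y) * u $ y * v $ x)"
    by (subst sum.swap) (simp add: sum_distrib_right)
  also have "\<dots> = - (\<Sum>y<N. u $ y * (\<Sum>x<N. ?D $$ (y, x) * v $ x))"
    unfolding sum_negf[symmetric] sum_distrib_left
  proof (intro sum.cong refl)
    fix x y assume "y \<in> {..<N}" "x \<in> {..<N}"
    then have "?D $$ (x, y) = - ?D $$ (y, x)" by (intro fourier_D1_skew) auto
    then show "?D $$ (x, y) * u $ y * v $ x = - (u $ y * (?D $$ (y, x) * v $ x))" by simp
  qed
  also have "(\<Sum>y<N. u $ y * (\<Sum>x<N. ?D $$ (y, x) * v $ x)) = u \<bullet> (?D *\<^sub>v v)"
    using D mult_mat_vec_index_sum[OF D v] by (auto simp: scalar_prod_def atLeast0LessThan)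
  finally show ?thesis .
qed

section \<open>Energy conservation over one step\<close>

text \<open>The auxiliary variable \<open>q\<close> in place of the square of \<open>u\<close> makes
  the cubic term bilinear, within reach of the product rule. The constant factor
  \<open>mesh_size\<close> is left out.\<close>

definition quadratic_energy :: "real \<Rightarrow> real \<Rightarrow> nat \<Rightarrow> real \<Rightarrow> real \<Rightarrow> real vec \<Rightarrow> real vec \<Rightarrow> real" where
  "quadratic_energy a b N \<eta> \<mu> u q =
     - \<eta> / 6 * (u \<bullet> q) + \<mu>\<^sup>2 / 2 * ((fourier_D1 a b N *\<^sub>v u) \<bullet> (fourier_D1 a b N *\<^sub>v u))"

text \<open>The order of the endpoints makes the mesh size nonnegative, so squaring
  \<open>norm_h\<close> cancels its square root.\<close>

lemma discrete_energy_eq_quadratic_energy: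
  assumes "a \<le> b" and "u \<in> carrier_vec N"
  shows "discrete_energy a b N \<eta> \<mu> u = mesh_size a b N * quadratic_energy a b N \<eta> \<mu> u (u ^\<^sub>v 2)"
proof -
  have "(u ^\<^sub>v 3) \<bullet> grid_one N = u \<bullet> (u ^\<^sub>v 2)"
    using assms
    by (auto simp: scalar_prod_def grid_pow_def grid_one_def power2_eq_square power3_eq_cube mult.assoc)
  moreover have "v \<bullet> v \<ge> 0" for v :: "real vec"
    by (auto simp: scalar_prod_def intro!: sum_nonneg)
  moreover have "mesh_size a b N \<ge> 0"
    using assms by (simp add: mesh_size_def)
  ultimately show ?thesis
    by (simp add: discrete_energy_def quadratic_energy_def norm_h_def inner_h_def algebra_simps)
qed

lemma qav_rk_step_conserves:
  assumes symp: "symplectic_rk s A w"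
    and u: "u \<in> carrier_vec N" and q: "q \<in> carrier_vec N"
    and step: "qav_rk_step a b N \<eta> \<mu> dt s A w u q u' q'"
  shows "q = u ^\<^sub>v 2 \<Longrightarrow> q' = u' ^\<^sub>v 2"
    and "quadratic_energy a b N \<eta> \<mu> u' q' = quadratic_energy a b N \<eta> \<mu> u q"
proof -
  let ?D = "fourier_D1 a b N"
  \<comment> \<open>The discrete variational derivative of the energy, for which the scheme reads
    \<open>k i = D g\<close>.\<close>
  define g where "g = (\<lambda>U Q. (- \<eta> / 6) \<cdot>\<^sub>v Q - (\<eta> / 3) \<cdot>\<^sub>v (U ^\<^sub>v 2) - \<mu>\<^sup>2 \<cdot>\<^sub>v ((?D ^\<^sub>m 2) *\<^sub>v U))"
  obtain U Q k l where
    carrier: "U \<in> {1..s} \<rightarrow> carrier_vec N" "Q \<in> {1..s} \<rightarrow> carrier_vec N"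
      and k: "k \<in> {1..s} \<rightarrow> carrier_vec N" and l: "l \<in> {1..s} \<rightarrow> carrier_vec N"
    and U: "\<forall>i\<in>{1..s}. U i = rk_comb N dt s (A i) k u"
    and Q: "\<forall>i\<in>{1..s}. Q i = rk_comb N dt s (A i) l q"
    and k_eq: "\<forall>i\<in>{1..s}. k i = ?D *\<^sub>v g (U i) (Q i)"
    and l_eq: "\<forall>i\<in>{1..s}. l i = 2 \<cdot>\<^sub>v (U i \<odot> k i)"
    and u': "u' = rk_comb N dt s w k u" and q': "q' = rk_comb N dt s w l q"
    using step unfolding qav_rk_step_def g_def by blast
  note D = fourier_D1_carrier[of a b N]
  show "q' = u' ^\<^sub>v 2" if q_eq: "q = u ^\<^sub>v 2"
  proof (rule eq_vecI)
    have u'N: "u' \<in> carrier_vec N" and q'N: "q' \<in> carrier_vec N"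
      unfolding u' q' by (intro rk_comb_carrier u q k l)+
    then show "dim_vec q' = dim_vec (u' ^\<^sub>v 2)" by (simp add: grid_pow_def)
    fix x assume "x < dim_vec (u' ^\<^sub>v 2)"
    then have x: "x < N" using u'N by (simp add: grid_pow_def)
    have "(u' ^\<^sub>v 2) $ x = u' $ x * u' $ x"
      using x u'N by (simp add: grid_pow_def power2_eq_square)
    \<comment> \<open>Product rule with both factors equal to component \<open>x\<close> of
      \<open>u\<close>; its stage terms are the components of \<open>l i\<close>.\<close>
    also have "\<dots> = u $ x * u $ x + dt * (\<Sum>i\<in>{1..s}. w i * (U i $ x * k i $ x + k i $ x * U i $ x))"
      unfolding u' rk_comb_index[OF u k x]
      by (intro symplectic_rk_product_rule[OF symp])
         (intro ballI, simp only: bspec[OF U] rk_comb_index[OF u k x])+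
    also have "u $ x * u $ x = q $ x"
      using u x by (simp add: q_eq grid_pow_def power2_eq_square)
    also have "(\<Sum>i\<in>{1..s}. w i * (U i $ x * k i $ x + k i $ x * U i $ x)) = (\<Sum>i\<in>{1..s}. w i * l i $ x)"
    proof (intro sum.cong refl arg_cong2[of _ _ _ _ "(*)"])
      fix i assume "i \<in> {1..s}"
      then show "U i $ x * k i $ x + k i $ x * U i $ x = l i $ x"
        using funcset_mem[OF k, of i] x l_eq by (simp add: grid_mult_def)
    qed
    finally show "q' $ x = (u' ^\<^sub>v 2) $ x"
      unfolding q' rk_comb_index[OF q l x] by simp
  qed
  have Du: "?D *\<^sub>v u \<in> carrier_vec N" and Dk: "(\<lambda>i. ?D *\<^sub>v k i) \<in> {1..s} \<rightarrow> carrier_vec N"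
    using D u funcset_mem[OF k] by (auto intro!: Pi_I)
  have DU: "\<forall>i\<in>{1..s}. ?D *\<^sub>v U i = rk_comb N dt s (A i) (\<lambda>j. ?D *\<^sub>v k j) (?D *\<^sub>v u)"
    using U mult_mat_rk_comb[OF D u k] by simp
  \<comment> \<open>The left side is the rate of change of the quadratic energy at stage
    \<open>i\<close>; it will be identified with \<open>k i \<bullet> g (U i) (Q i)\<close>.\<close>
  have stage: "- \<eta> / 6 * (U i \<bullet> l i + k i \<bullet> Q i)
      + \<mu>\<^sup>2 / 2 * ((?D *\<^sub>v U i) \<bullet> (?D *\<^sub>v k i) + (?D *\<^sub>v k i) \<bullet> (?D *\<^sub>v U i)) = 0"
    if i: "i \<in> {1..s}" for i
  proof -
    note UN = funcset_mem[OF carrier(1) i] and QN = funcset_mem[OF carrier(2) i] and kN = funcset_mem[OF k i]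
    have DUN: "?D *\<^sub>v U i \<in> carrier_vec N" and DkN: "?D *\<^sub>v k i \<in> carrier_vec N"
      and DDUN: "?D *\<^sub>v (?D *\<^sub>v U i) \<in> carrier_vec N"
      using D UN kN by auto
    have sqN: "U i ^\<^sub>v 2 \<in> carrier_vec N" using UN by (simp add: grid_pow_def)
    have "(?D ^\<^sub>m 2) *\<^sub>v U i = ?D *\<^sub>v (?D *\<^sub>v U i)"
      using D UN by (simp add: numeral_2_eq_2)
    then have g: "g (U i) (Q i)
        = (- \<eta> / 6) \<cdot>\<^sub>v Q i - (\<eta> / 3) \<cdot>\<^sub>v (U i ^\<^sub>v 2) - \<mu>\<^sup>2 \<cdot>\<^sub>v (?D *\<^sub>v (?D *\<^sub>v U i))"
      by (simp add: g_def)
    have gN: "g (U i) (Q i) \<in> carrier_vec N"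
      unfolding g using QN sqN DDUN by auto
    \<comment> \<open>With \<open>k i = D g\<close>, skew-symmetry makes this product equal to its
      own negative, up to commuting the factors.\<close>
    have "k i \<bullet> g (U i) (Q i) = - (g (U i) (Q i) \<bullet> k i)"
      using fourier_D1_scalar_prod[OF gN gN, of a b] bspec[OF k_eq i] by metis
    then have 0: "k i \<bullet> g (U i) (Q i) = 0"
      using comm_scalar_prod[OF kN gN] by simp
    \<comment> \<open>The factor 2 from \<open>l i\<close> turns \<open>\<eta> / 6\<close> into the
      coefficient \<open>\<eta> / 3\<close> of the squared stage in \<open>g\<close>.\<close>
    have lk: "U i \<bullet> l i = 2 * (k i \<bullet> (U i ^\<^sub>v 2))"
      using UN kN by (simp add: bspec[OF l_eq i] scalar_prod_def grid_mult_def grid_pow_def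
          power2_eq_square sum_distrib_left mult_ac)
    have Dk_DU: "(?D *\<^sub>v k i) \<bullet> (?D *\<^sub>v U i) = - (k i \<bullet> (?D *\<^sub>v (?D *\<^sub>v U i)))"
      using kN DUN by (rule fourier_D1_scalar_prod)
    have "k i \<bullet> g (U i) (Q i)
        = - \<eta> / 6 * (k i \<bullet> Q i) - \<eta> / 3 * (k i \<bullet> (U i ^\<^sub>v 2)) - \<mu>\<^sup>2 * (k i \<bullet> (?D *\<^sub>v (?D *\<^sub>v U i)))"
      unfolding g using kN QN sqN DDUN
      by (simp add: scalar_prod_minus_distrib[of _ N])
    then show ?thesis
      using 0 lk Dk_DU comm_scalar_prod[OF DUN DkN] by (simp add: algebra_simps)
  qed
  \<comment> \<open>The product rule is used for the pair \<open>u\<close>, \<open>q\<close> and for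
    \<open>?D *\<^sub>v u\<close> paired with itself.\<close>
  have "quadratic_energy a b N \<eta> \<mu> u' q' = quadratic_energy a b N \<eta> \<mu> u q
      + dt * (\<Sum>i\<in>{1..s}. w i * (- \<eta> / 6 * (U i \<bullet> l i + k i \<bullet> Q i)
        + \<mu>\<^sup>2 / 2 * ((?D *\<^sub>v U i) \<bullet> (?D *\<^sub>v k i) + (?D *\<^sub>v k i) \<bullet> (?D *\<^sub>v U i))))"
    unfolding quadratic_energy_def u' q' mult_mat_rk_comb[OF D u k]
      symplectic_rk_scalar_prod[OF symp u q k l U Q]
      symplectic_rk_scalar_prod[OF symp Du Du Dk Dk DU DU]
    by (simp add: algebra_simps sum.distrib sum_distrib_left sum_negf sum_subtractf)
  also have "(\<Sum>i\<in>{1..s}. w i * (- \<eta> / 6 * (U i \<bullet> l i + k i \<bullet> Q i)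
        + \<mu>\<^sup>2 / 2 * ((?D *\<^sub>v U i) \<bullet> (?D *\<^sub>v k i) + (?D *\<^sub>v k i) \<bullet> (?D *\<^sub>v U i)))) = 0"
    by (intro sum.neutral ballI) (simp only: stage mult_zero_right)
  finally show "quadratic_energy a b N \<eta> \<mu> u' q' = quadratic_energy a b N \<eta> \<mu> u q"
    by simp
qed

theorem theorem4p2:
  fixes \<eta> \<mu> a b dt :: real
    and N s Nt :: nat
    and A :: "nat \<Rightarrow> nat \<Rightarrow> real" and w :: "nat \<Rightarrow> real"
    and u q :: "nat \<Rightarrow> real vec"
  assumes "a < b" and "dt > 0" and "N > 0" and "even N" and "s \<ge> 1" and "Nt \<ge> 1"
    and "symplectic_rk s A w"
    and "\<And>n. n \<le> Nt \<Longrightarrow> u n \<in> carrier_vec N"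
    and "\<And>n. n \<le> Nt \<Longrightarrow> q n \<in> carrier_vec N"
    and "\<And>n. n < Nt \<Longrightarrow>
           qav_rk_step a b N \<eta> \<mu> dt s A w (u n) (q n) (u (Suc n)) (q (Suc n))"
    and "q 0 = (u 0) ^\<^sub>v 2"
  shows "\<forall>n\<le>Nt. discrete_energy a b N \<eta> \<mu> (u n) = discrete_energy a b N \<eta> \<mu> (u 0)"
proof -
  \<comment> \<open>The relation between \<open>q n\<close> and \<open>u n\<close> is carried along
    because it turns the quadratic energy back into the original one at every time level.\<close>
  have inv: "q n = u n ^\<^sub>v 2 \<and>
      quadratic_energy a b N \<eta> \<mu> (u n) (q n) = quadratic_energy a b N \<eta> \<mu> (u 0) (q 0)"
    if "n \<le> Nt" for n
    using that
  proof (induction n)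
    case 0
    then show ?case using assms(11) by simp
  next
    case (Suc n)
    then have n: "n < Nt" "n \<le> Nt" by auto
    note step = qav_rk_step_conserves[OF assms(7) assms(8)[OF n(2)] assms(9)[OF n(2)] assms(10)[OF n(1)]]
    show ?case using Suc.IH[OF n(2)] step by metis
  qed
  have "discrete_energy a b N \<eta> \<mu> (u n) = mesh_size a b N * quadratic_energy a b N \<eta> \<mu> (u n) (q n)"
    if "n \<le> Nt" for n
    using discrete_energy_eq_quadratic_energy[OF less_imp_le[OF assms(1)] assms(8)[OF that]] inv[OF that]
    by simp
  then show ?thesis using inv by (metis le0)
qed

end
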